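(* Let $m$ be a positive integer. Then for every positive integer $N$, $$\left|S_N\big(\sqrt{m^2+1}-m+1\big)\right| \le \frac{\log N}{2 \log ( \sqrt{m^2+1}+m)} + 1.$$
   Context: For a real number $\alpha$ and an integer $N\ge 0$, $S_N(\alpha) := \sum_{n=1}^N (-1)^{\lfloor n\alpha\rfloor}$, where $\lfloor x\rfloor$ is the greatest integer not larger than $x$. $\log$ is the natural logarithm. *)

theory Defs
  imports Complex_Main
begin

definition S :: "nat \<Rightarrow> real \<Rightarrow> real" where
  "S N \<alpha> = (\<Sum>n=1..N. (-1) powi \<lfloor>real n * \<alpha>\<rfloor>)"

end

theory Submission
  imports Defs
begin

text \<open>
  Write \<open>\<beta> = sqrt (m\<^sup>2 + 1) - m\<close>, so that \<open>1 / \<beta> = 2 m + \<beta>\<close> is the number inside the logarithm, and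
  the summand is \<open>(-1) ^ (n + K n)\<close> with \<open>K n = \<lfloor>n \<beta>\<rfloor>\<close>. On a maximal run of consecutive \<open>n\<close> with
  the same \<open>K n = k\<close> the summands alternate, so a run of even length contributes nothing and one
  of odd length contributes its first summand. As \<open>1 / \<beta>\<close> lies just above the even number
  \<open>2 m\<close>, the runs have length \<open>2 m\<close> or \<open>2 m + 1\<close>, and the long ones are those with
  \<open>K (k + 1) = K k + 1\<close>. Numbering the long runs by \<open>j = K (k + 1)\<close>, the contribution of the
  \<open>j\<close>-th one turns out to be \<open>(-1) ^ (j + K j)\<close>, a summand of the same sum again.

  Hence the sum up to \<open>N\<close> equals the sum up to \<open>K (K N)\<close>, up to the contribution of the last,
  incomplete run, which is \<open>0\<close> or \<open>\<plusminus>1\<close> (\<open>alternating_sum_renormalise\<close>). If \<open>K (K N) = 0\<close>, only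
  this contribution remains and the sum is at most \<open>1\<close> in absolute value. Otherwise, passing
  from \<open>N\<close> to \<open>K (K N) \<le> \<beta>\<^sup>2 N\<close> lowers \<open>ln N / (2 ln (1 / \<beta>))\<close> by at least \<open>1\<close>, which pays for
  the error of at most \<open>1\<close>, and the bound follows by strong induction on \<open>N\<close>.
\<close>

text \<open>
  The equation says \<open>1 / \<beta> = 2 m + \<beta>\<close>, that is, \<open>\<beta>\<close> has the periodic continued fraction
  \<open>[0; 2 m, 2 m, \<dots>]\<close>; the proof uses \<open>\<beta>\<close> only through this self-similarity.
\<close>
locale even_quadratic_slope =
  fixes m :: nat and \<beta> :: real
  assumes m_pos: "m > 0" and \<beta>_pos: "\<beta> > 0" and \<beta>_eq: "\<beta> * (2 * real m + \<beta>) = 1"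
begin

definition K :: "nat \<Rightarrow> nat" where
  "K n = nat \<lfloor>real n * \<beta>\<rfloor>"

definition T :: "nat \<Rightarrow> int" where
  "T N = (\<Sum>n=1..N. (-1) ^ (n + K n))"

lemma \<beta>_less_1: "\<beta> < 1"
proof (rule ccontr)
  assume "\<not> \<beta> < 1"
  moreover have "2 * real m + \<beta> > 1" using m_pos \<beta>_pos by simp
  ultimately have "1 * 1 < \<beta> * (2 * real m + \<beta>)"
    by (intro mult_le_less_imp_less) auto
  with \<beta>_eq show False by simp
qed

lemma K_eqI: "real k \<le> real n * \<beta> \<Longrightarrow> real n * \<beta> < real k + 1 \<Longrightarrow> K n = k"
  unfolding K_def by (metis floor_unique nat_int of_int_of_nat_eq)

lemma K_le: "real (K n) \<le> real n * \<beta>"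
  using \<beta>_pos unfolding K_def by simp

lemma less_Suc_K: "real n * \<beta> < real (K n) + 1"
  using \<beta>_pos unfolding K_def by simp

lemma K_0 [simp]: "K 0 = 0"
  by (simp add: K_def)

lemma T_0 [simp]: "T 0 = 0"
  by (simp add: T_def)

lemma T_Suc: "T (Suc N) = T N + (-1) ^ (Suc N + K (Suc N))"
  by (simp add: T_def)

lemma K_Suc_cases: "K (Suc n) = K n \<or> K (Suc n) = Suc (K n)"
proof -
  have step: "real (Suc n) * \<beta> = real n * \<beta> + \<beta>" by (simp add: algebra_simps)
  have "real (K (Suc n)) < real (K n) + 2"
    using K_le[of "Suc n"] less_Suc_K[of n] \<beta>_less_1 step by linarith
  moreover have "real (K n) < real (K (Suc n)) + 1"
    using K_le[of n] less_Suc_K[of "Suc n"] \<beta>_pos step by linarith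
  ultimately show ?thesis by linarith
qed

text \<open>
  Otherwise \<open>sqrt (m\<^sup>2 + 1) = \<beta> + m\<close> would be rational, hence an integer \<open>c\<close>, whereas
  \<open>m\<^sup>2 + 1\<close> lies strictly between the squares of \<open>m\<close> and \<open>m + 1\<close>.
\<close>
lemma multiple_not_nat:
  assumes "n > 0"
  shows "real n * \<beta> \<noteq> real k"
proof
  assume k: "real n * \<beta> = real k"
  have "(real n * \<beta> + real m * real n)\<^sup>2
      = (real n)\<^sup>2 * (\<beta> * (2 * real m + \<beta>)) + (real m)\<^sup>2 * (real n)\<^sup>2"
    by (simp add: power2_eq_square algebra_simps)
  also have "\<dots> = (real m ^ 2 + 1) * (real n)\<^sup>2"
    by (simp only: \<beta>_eq mult_1_right) (simp add: distrib_right)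
  finally have "real ((k + m * n)\<^sup>2) = real ((m\<^sup>2 + 1) * n\<^sup>2)"
    by (simp add: k distrib_right)
  hence sq: "(k + m * n)\<^sup>2 = (m\<^sup>2 + 1) * n\<^sup>2"
    by (simp only: of_nat_eq_iff)
  hence "n\<^sup>2 dvd (k + m * n)\<^sup>2" by simp
  hence "n dvd k + m * n" by simp
  then obtain c where "k + m * n = n * c" by blast
  with sq have "n\<^sup>2 * c\<^sup>2 = n\<^sup>2 * (m\<^sup>2 + 1)"
    by (simp only: power_mult_distrib mult.commute)
  with assms have c: "c\<^sup>2 = m\<^sup>2 + 1"
    by (simp only: mult_cancel1) simp
  hence "m\<^sup>2 < c\<^sup>2" by simp
  hence "m < c" by (rule power_less_imp_less_base) simp
  hence "(Suc m)\<^sup>2 \<le> c\<^sup>2" by (intro power_mono) auto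
  with c m_pos show False by (simp add: power2_eq_square)
qed

text \<open>
  The run on which \<open>K\<close> takes the value \<open>k\<close> begins just above \<open>k / \<beta> = 2 m k + k \<beta>\<close>. So the parity
  of its starting point is governed by \<open>K k\<close>: this is where the self-similarity comes from, and
  where it matters that the partial quotient \<open>2 m\<close> is even.
\<close>
lemma K_jump:
  assumes "K (Suc n) = Suc (K n)"
  shows "n = 2 * m * K (Suc n) + K (K (Suc n))"
proof -
  define k where "k = K (Suc n)"
  have lo: "real n * \<beta> < real k"
    using less_Suc_K[of n] assms by (simp add: k_def)
  have hi: "real k < real (Suc n) * \<beta>"
    using K_le[of "Suc n"] multiple_not_nat[of "Suc n" k] by (simp add: k_def)
  let ?L = "2 * real m + \<beta>"
  have L_pos: "?L > 0" using \<beta>_pos by simp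
  have inv: "x * \<beta> * ?L = x" for x
    using \<beta>_eq by (simp only: mult.assoc mult_1_right)
  have n_less: "real n < real k * ?L"
    using mult_strict_right_mono[OF lo L_pos] by (simp only: inv)
  have less_Suc_n: "real k * ?L < real (Suc n)"
    using mult_strict_right_mono[OF hi L_pos] by (simp only: inv)
  have split: "real k * ?L = real (2 * m * k) + real k * \<beta>"
    by (simp add: algebra_simps)
  have "2 * m * k \<le> n"
  proof -
    have "real (2 * m * k) \<le> real k * ?L" using split \<beta>_pos by simp
    with less_Suc_n have "real (2 * m * k) < real (Suc n)" by linarith
    thus ?thesis by linarith
  qed
  then obtain r where r: "n = 2 * m * k + r" by (auto simp: le_iff_add)
  have "K k = r"
    by (rule K_eqI) (use n_less less_Suc_n split r in auto)
  with r show ?thesis by (simp add: k_def)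
qed

text \<open>
  The subtracted term is the contribution of the last run \<open>k = K N\<close>: this run starts at an
  \<open>n\<close> of parity \<open>K k + 1\<close> (by \<open>K_jump\<close>), so its part up to \<open>N\<close> has odd length iff \<open>N + K k\<close> is
  odd, and it then contributes its first summand \<open>- (-1) ^ (k + K k)\<close>.
\<close>
lemma alternating_sum_renormalise:
  "T N = T (K (K N)) - (if odd (N + K (K N)) then (-1) ^ (K N + K (K N)) else 0)"
proof (induction N)
  case 0
  show ?case by simp
next
  case (Suc N)
  show ?case
  proof (cases "K (Suc N) = K N")
    case True
    show ?thesis
      unfolding T_Suc True using Suc.IH by (auto simp: minus_one_power_iff)
  next
    case False
    hence k: "K (Suc N) = Suc (K N)" using K_Suc_cases[of N] by blast
    have N: "N = 2 * m * K (Suc N) + K (K (Suc N))" by (rule K_jump[OF k])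
    have parN: "even N \<longleftrightarrow> even (K (Suc (K N)))"
      by (subst N) (simp add: k)
    show ?thesis
    proof (cases "K (Suc (K N)) = K (K N)")
      case True
      \<comment> \<open>The run that has just ended is short and cancels.\<close>
      show ?thesis
        unfolding T_Suc k True using Suc.IH parN True by (auto simp: minus_one_power_iff)
    next
      case False
      \<comment> \<open>The run that has just ended is long and becomes the next summand of the shorter sum.\<close>
      hence j: "K (Suc (K N)) = Suc (K (K N))" using K_Suc_cases[of "K N"] by blast
      have kN: "K N = 2 * m * K (Suc (K N)) + K (K (Suc (K N)))" by (rule K_jump[OF j])
      have parK: "even (K N) \<longleftrightarrow> even (K (Suc (K (K N))))"
        by (subst kN) (simp add: j)
      show ?thesis
        unfolding T_Suc k j using Suc.IH parN parK j by (auto simp: minus_one_power_iff)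
    qed
  qed
qed

lemma abs_alternating_sum_le:
  assumes "N > 0"
  shows "\<bar>real_of_int (T N)\<bar> \<le> ln (real N) / (2 * ln (1 / \<beta>)) + 1"
  using assms
proof (induction N rule: less_induct)
  case (less N)
  define J where "J = K (K N)"
  have ln_pos: "ln (1 / \<beta>) > 0" using \<beta>_pos \<beta>_less_1 by simp
  have step: "\<bar>real_of_int (T N)\<bar> \<le> \<bar>real_of_int (T J)\<bar> + 1"
    by (subst alternating_sum_renormalise) (auto simp: J_def minus_one_power_iff)
  show ?case
  proof (cases "J = 0")
    case True
    have "ln (real N) / (2 * ln (1 / \<beta>)) \<ge> 0" using less.prems ln_pos by simp
    with step True show ?thesis by simp
  next
    case False
    have "real J \<le> real (K N) * \<beta>" unfolding J_def by (rule K_le)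
    also have "\<dots> \<le> real N * \<beta> * \<beta>" using K_le[of N] \<beta>_pos by simp
    finally have J_le: "real J \<le> real N * \<beta>\<^sup>2" by (simp add: power2_eq_square mult.assoc)
    have "\<beta>\<^sup>2 < 1" using \<beta>_pos \<beta>_less_1 by (simp add: power_less_one_iff)
    hence "real N * \<beta>\<^sup>2 < real N" using less.prems by simp
    with J_le have "J < N" by linarith
    with False less.IH have IH: "\<bar>real_of_int (T J)\<bar> \<le> ln (real J) / (2 * ln (1 / \<beta>)) + 1"
      by simp
    have "ln (real J) \<le> ln (real N * \<beta>\<^sup>2)" using J_le False by simp
    also have "\<dots> = ln (real N) - 2 * ln (1 / \<beta>)"
      using less.prems \<beta>_pos by (simp add: ln_mult ln_realpow ln_div)
    finally have "ln (real J) / (2 * ln (1 / \<beta>)) \<le> ln (real N) / (2 * ln (1 / \<beta>)) - 1"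
      using ln_pos by (simp add: field_simps)
    with IH step show ?thesis by linarith
  qed
qed

lemma S_eq_alternating_sum: "S N (1 + \<beta>) = real_of_int (T N)"
proof -
  have "(-1 :: real) powi \<lfloor>real n * (1 + \<beta>)\<rfloor> = (-1) ^ (n + K n)" for n
  proof -
    have "real n * (1 + \<beta>) = real n * \<beta> + of_int (int n)" by (simp add: algebra_simps)
    hence "\<lfloor>real n * (1 + \<beta>)\<rfloor> = \<lfloor>real n * \<beta>\<rfloor> + int n"
      by (simp only: floor_add_int)
    also have "\<dots> = int (n + K n)" using \<beta>_pos by (simp add: K_def)
    finally show ?thesis by (simp only: power_int_of_nat)
  qed
  thus ?thesis by (simp add: S_def T_def)
qed

end

theorem theorem3p1:
  fixes m N :: nat
  assumes "m > 0" and "N > 0"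
  shows "\<bar>S N (sqrt ((real m)\<^sup>2 + 1) - real m + 1)\<bar>
           \<le> ln (real N) / (2 * ln (sqrt ((real m)\<^sup>2 + 1) + real m)) + 1"
proof -
  define r where "r = sqrt ((real m)\<^sup>2 + 1)"
  have r_sq: "r * r = (real m)\<^sup>2 + 1" by (simp add: r_def)
  have r_gt: "r > real m" unfolding r_def by (rule real_less_rsqrt) simp
  interpret even_quadratic_slope m "r - real m"
    by unfold_locales (use assms r_gt r_sq in \<open>auto simp: algebra_simps power2_eq_square\<close>)
  have "1 / (r - real m) = r + real m"
    using r_gt r_sq by (simp add: field_simps power2_eq_square)
  with abs_alternating_sum_le[OF assms(2)] S_eq_alternating_sum[of N] show ?thesis
    by (simp add: r_def add.commute)
qed

end
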